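(* Let $G=d_1d_2\ldots d_n$ be a \textsc{flipping coins} position. If $d_1d_2\ldots d_n$ contains a non-zero even number of $1$s, or if $d_1=1$ and there are at least two $1$s, then Left wins $G$ (that is, Left has a winning strategy whether she moves first or second; equivalently $G>0$).
   Context: \textsc{Flipping coins}: a position is a finite string $d_1d_2\ldots d_n$ with each $d_i\in\{0,1\}$ (written left to right). Any $0$s after the last $1$ are deleted, so a position is either empty or ends in $1$. A Left move chooses indices $i<j$ with $d_i=d_j=1$ and changes both to $0$. A Right move chooses indices $k<\ell$ with $d_k=0$ and $d_\ell=1$, and changes $d_k$ to $1$ and $d_\ell$ to $0$. After any move, all $0$s following the last $1$ are deleted. The game is played under normal play: a player unable to move loses. *)

theory Defs
  imports Main "HOL-Library.More_List"
begin

text \<open>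
  A position \<open>d\<^sub>1 d\<^sub>2 \<dots> d\<^sub>n\<close> is the list of its digits, so
  \<open>d\<^sub>i\<close> is \<open>G ! (i - 1)\<close>.
\<close>

definition position :: "nat list \<Rightarrow> bool" where
  "position G \<longleftrightarrow> set G \<subseteq> {0, 1} \<and> no_trailing ((=) 0) G"

definition trim :: "nat list \<Rightarrow> nat list" where
  "trim = strip_while ((=) 0)"

definition left_move :: "nat list \<Rightarrow> nat list \<Rightarrow> bool" where
  "left_move G H \<longleftrightarrow>
     (\<exists>i j. i < j \<and> j < length G \<and> G ! i = 1 \<and> G ! j = 1 \<and> H = trim (G[i := 0, j := 0]))"

definition right_move :: "nat list \<Rightarrow> nat list \<Rightarrow> bool" where
  "right_move G H \<longleftrightarrow>
     (\<exists>k l. k < l \<and> l < length G \<and> G ! k = 0 \<and> G ! l = 1 \<and> H = trim (G[k := 1, l := 0]))"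

text \<open>
  Existence of a winning strategy for Left under normal play, according to who moves next:
  when Left moves first she needs a move to a position that she wins moving second, so she loses
  if she cannot move; when she moves second she must win moving first after every move of Right,
  so she wins if Right cannot move. Since the definition is inductive, play following the strategy
  ends after finitely many moves.
\<close>

inductive left_wins_first :: "nat list \<Rightarrow> bool"
  and left_wins_second :: "nat list \<Rightarrow> bool" where
  first: "left_move G H \<Longrightarrow> left_wins_second H \<Longrightarrow> left_wins_first G"
| second: "(\<And>H. right_move G H \<Longrightarrow> left_wins_first H) \<Longrightarrow> left_wins_second G"

definition left_wins :: "nat list \<Rightarrow> bool" where
  "left_wins G \<longleftrightarrow> left_wins_first G \<and> left_wins_second G"

end

(* Right's moves preserve the number of 1s and leave d_1 = 1 in place, since a 1 is only ever moved
   to the left. Left's moves lower the number of 1s by two. So Left keeps the number of 1s even, or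
   keeps d_1 = 1 by never selecting d_1 while there are three or more 1s. In both cases Right has a
   move only if at least two 1s remain, and then Left can answer. *)

theory Submission
  imports Defs
begin

text \<open>Indices count from 0, so \<open>0 \<in> ones G\<close> expresses d_1 = 1. The set is
  blind to trailing zeros, so trimming can be ignored and moves become set operations.\<close>

definition ones :: "nat list \<Rightarrow> nat set" where
  "ones G = {i. i < length G \<and> G ! i = 1}"

lemma finite_ones [simp]: "finite (ones G)"
  by (simp add: ones_def)

lemma count_list_eq_card_ones: "count_list G 1 = card (ones G)"
  by (simp add: ones_def count_list_eq_length_filter length_filter_conv_card eq_commute)

lemma ones_snoc_zero: "ones (G @ [0]) = ones G"
  by (auto simp: ones_def nth_append less_Suc_eq)

lemma ones_trim [simp]: "ones (trim G) = ones G"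
proof (induction G rule: rev_induct)
  case (snoc x G)
  then show ?case
    by (cases "x = 0") (simp_all add: trim_def ones_snoc_zero)
qed (simp add: trim_def)

lemma right_move_onesE:
  assumes "right_move G H"
  obtains k l where "k < l" "k \<notin> ones G" "l \<in> ones G" "ones H = insert k (ones G - {l})"
proof -
  from assms obtain k l where kl: "k < l" "l < length G" "G ! k = 0" "G ! l = 1"
    and H: "H = trim (G[k := 1, l := 0])"
    unfolding right_move_def by blast
  have "ones H = insert k (ones G - {l})"
    unfolding H ones_trim using kl by (auto simp: ones_def nth_list_update split: if_splits)
  with kl that show thesis
    by (simp add: ones_def)
qed

text \<open>The pair is unordered because Left's reply will pick any two elements of a set; the
  proof sorts them.\<close>

lemma left_move_onesI:
  assumes "i \<in> ones G" "j \<in> ones G" "i \<noteq> j"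
  obtains H where "left_move G H" "ones H = ones G - {i, j}"
proof -
  have *: "\<exists>H. left_move G H \<and> ones H = ones G - {a, b}"
    if "a < b" "a \<in> ones G" "b \<in> ones G" for a b
  proof (intro exI conjI)
    show "left_move G (trim (G[a := 0, b := 0]))"
      using that by (auto simp: left_move_def ones_def)
    show "ones (trim (G[a := 0, b := 0])) = ones G - {a, b}"
      unfolding ones_trim using that by (auto simp: ones_def nth_list_update split: if_splits)
  qed
  from assms(3) consider "i < j" | "j < i"
    by linarith
  then show thesis
    using *[of i j] *[of j i] assms that by cases (auto simp: insert_commute)
qed

text \<open>The invariant that Left restores with each reply. Beyond the positions of the theorem it
  admits those with no 1s and those with a single 1 in front, where neither player can move, so that
  Left wins there only as second player.\<close>

definition left_safe :: "nat list \<Rightarrow> bool" where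
  "left_safe G \<longleftrightarrow> even (card (ones G)) \<or> 0 \<in> ones G"

lemma left_safe_right_move:
  assumes "right_move G H" "left_safe G"
  shows "left_safe H" "card (ones H) = card (ones G)" "2 \<le> card (ones H)"
proof -
  from assms(1) obtain k l where kl: "k < l" "k \<notin> ones G" "l \<in> ones G"
    and H: "ones H = insert k (ones G - {l})"
    by (rule right_move_onesE)
  have pos: "0 < card (ones G)"
    using kl by (auto simp: card_gt_0_iff)
  show card: "card (ones H) = card (ones G)"
    using kl pos by (simp add: H card_Diff_singleton)
  show "left_safe H"
    using assms(2) kl by (auto simp: left_safe_def card) (auto simp: H)
  \<comment> \<open>Even case: the count is positive because of \<open>l\<close>. Odd case:
    \<open>l\<close> is a second element besides \<open>0\<close>, since \<open>k < l\<close> forces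
    \<open>l\<close> to be nonzero.\<close>
  have "2 \<le> card (ones G)"
  proof (cases "even (card (ones G))")
    case True
    with pos show ?thesis
      by (auto elim!: evenE)
  next
    case False
    with assms(2) have "{0, l} \<subseteq> ones G"
      using kl by (simp add: left_safe_def)
    then have "card {0, l} \<le> card (ones G)"
      by (intro card_mono) auto
    with kl show ?thesis
      by simp
  qed
  then show "2 \<le> card (ones H)"
    by (simp add: card)
qed

lemma left_safe_left_move:
  assumes "left_safe G" "2 \<le> card (ones G)"
  obtains H where "left_move G H" "left_safe H" "card (ones H) < card (ones G)"
proof -
  \<comment> \<open>The 1s that Left may spend: with an odd count, index 0 is withheld so that it
    survives the move.\<close>
  define A where "A = (if even (card (ones G)) then ones G else ones G - {0})"
  have A: "A \<subseteq> ones G"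
    by (auto simp: A_def)
  have "2 \<le> card A"
  proof (cases "even (card (ones G))")
    case False
    \<comment> \<open>An odd count that is at least 2 is at least 3, so two 1s remain besides index
      0.\<close>
    then have "card (ones G) \<noteq> 2"
      by auto
    with False assms show ?thesis
      by (simp add: A_def left_safe_def card_Diff_singleton)
  qed (use assms in \<open>simp add: A_def\<close>)
  then obtain B where "B \<subseteq> A" "card B = 2"
    by (meson obtain_subset_with_card_n)
  then obtain i j where ij: "i \<in> A" "j \<in> A" "i \<noteq> j"
    by (auto simp: card_2_iff)
  with A obtain H where move: "left_move G H" and H: "ones H = ones G - {i, j}"
    by (meson left_move_onesI subsetD)
  have card: "card (ones H) = card (ones G) - 2"
    using ij A by (subst H, subst card_Diff_subset) auto
  have "left_safe H"
  proof (cases "even (card (ones G))")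
    case True
    then show ?thesis
      by (simp add: left_safe_def card)
  next
    case False
    then show ?thesis
      using ij assms(1) by (simp add: left_safe_def H A_def)
  qed
  with move card assms(2) that show thesis
    by simp
qed

text \<open>The measure is constant under Right's move and drops under Left's reply, so the
  induction hypothesis applies after each such pair. If Right cannot move, rule
  \<open>second\<close> applies vacuously; hence there is no separate base case.\<close>

lemma left_wins_second_if_left_safe: "left_safe G \<Longrightarrow> left_wins_second G"
proof (induction "card (ones G)" arbitrary: G rule: less_induct)
  case less
  show ?case
  proof (rule left_wins_first_left_wins_second.second)
    fix H
    assume "right_move G H"
    note H = left_safe_right_move[OF this less.prems]
    from H(1,3) obtain H' where "left_move H H'" "left_safe H'" "card (ones H') < card (ones H)"
      by (rule left_safe_left_move)
    with H(2) show "left_wins_first H"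
      by (auto intro: left_wins_first_left_wins_second.first less.hyps)
  qed
qed

lemma left_wins_first_if_left_safe:
  assumes "left_safe G" "2 \<le> card (ones G)"
  shows "left_wins_first G"
  using assms
  by (meson left_safe_left_move left_wins_first_left_wins_second.first
      left_wins_second_if_left_safe)

theorem theorem3p1:
  fixes G :: "nat list"
  assumes "position G"
    and "(count_list G 1 \<noteq> 0 \<and> even (count_list G 1)) \<or> (G ! 0 = 1 \<and> count_list G 1 \<ge> 2)"
  shows "left_wins G"
proof -
  note ones = assms(2)[unfolded count_list_eq_card_ones]
  then have two: "2 \<le> card (ones G)"
    by presburger
  \<comment> \<open>The value of \<open>[] ! 0\<close> is unspecified, so only for nonempty
    \<open>G\<close> does \<open>G ! 0 = 1\<close> give \<open>0 \<in> ones G\<close>.\<close>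
  then have "G \<noteq> []"
    by (auto simp: ones_def)
  then have "left_safe G"
    using ones by (auto simp: left_safe_def ones_def)
  with two show ?thesis
    by (simp add: left_wins_def left_wins_first_if_left_safe left_wins_second_if_left_safe)
qed

end
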